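(* Let $k$ be a positive integer and let $q$ be a prime power such that $q\ge e^{6k}\cdot(10\,e\,k^3)$. Then there exists an evaluation vector $\boldsymbol\alpha=(\alpha_1,\ldots,\alpha_q)$, i.e. an ordering of all elements of $\mathbb{F}_q$, such that the code $\mathrm{RS}_{q,k}(\boldsymbol\alpha)$ can correct any $q/(10k)$ insdel errors.
   Context: For distinct elements $\alpha_1,\ldots,\alpha_n\in\mathbb{F}_q$ and $k<n$, the Reed--Solomon code with evaluation vector $\boldsymbol\alpha=(\alpha_1,\ldots,\alpha_n)$ is $\mathrm{RS}_{n,k}(\boldsymbol\alpha)=\{(f(\alpha_1),\ldots,f(\alpha_n)) : f\in\mathbb{F}_q[x],\ \deg f<k\}\subseteq\mathbb{F}_q^n$. An insdel error is an insertion of a symbol or a deletion of a symbol. A code $\mathcal{C}\subseteq\mathbb{F}_q^n$ can correct $t$ insdel errors if no word can be obtained from two distinct codewords, each by at most $t$ insertions and deletions in total (if $t$ is not an integer, the number of errors is an integer at most $t$). Equivalently (for $0\le t\le n-1$), $\mathrm{LCS}(\mathbf{c},\mathbf{c}')\le n-\lfloor t\rfloor-1$ for all distinct $\mathbf{c},\mathbf{c}'\in\mathcal{C}$, where $\mathrm{LCS}$ denotes the length of a longest common (not necessarily contiguous) subsequence. Here $e$ is the base of the natural logarithm. *)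

theory Defs
  imports
    Complex_Main
    "HOL-Library.Cardinality"
    "HOL-Computational_Algebra.Polynomial"
    "HOL-Number_Theory.Prime_Powers"
begin

text \<open>
  The evaluation vector is a list. The case \<open>f = 0\<close> is listed separately because the library
  sets \<open>degree 0 = 0\<close>, whereas here the zero polynomial counts as having degree below every \<open>k\<close>.
\<close>
definition RS :: "'a::field list \<Rightarrow> nat \<Rightarrow> 'a list set" where
  "RS \<alpha> k = {map (poly f) \<alpha> | f. f = 0 \<or> degree f < k}"

definition insertion :: "'a list \<Rightarrow> 'a list \<Rightarrow> bool" where
  "insertion v w \<longleftrightarrow> (\<exists>xs a ys. v = xs @ ys \<and> w = xs @ a # ys)"

definition deletion :: "'a list \<Rightarrow> 'a list \<Rightarrow> bool" where
  "deletion v w \<longleftrightarrow> (\<exists>xs a ys. v = xs @ a # ys \<and> w = xs @ ys)"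

definition insdel_error :: "'a list \<Rightarrow> 'a list \<Rightarrow> bool" where
  "insdel_error v w \<longleftrightarrow> insertion v w \<or> deletion v w"

text \<open>The bound \<open>t\<close> may be any real number; the number \<open>m\<close> of errors is always a natural number.\<close>
definition obtainable :: "real \<Rightarrow> 'a list \<Rightarrow> 'a list \<Rightarrow> bool" where
  "obtainable t v w \<longleftrightarrow> (\<exists>m::nat. real m \<le> t \<and> (insdel_error ^^ m) v w)"

definition corrects_insdel :: "'a list set \<Rightarrow> real \<Rightarrow> bool" where
  "corrects_insdel C t \<longleftrightarrow>
     (\<forall>c\<in>C. \<forall>c'\<in>C. c \<noteq> c' \<longrightarrow> \<not> (\<exists>w. obtainable t c w \<and> obtainable t c' w))"

end

theory Submission
  imports Defs "HOL-Library.Sublist"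
begin

text \<open>
  Two codewords reaching a common word by at most \<open>t\<close> errors each share a subsequence of length at
  least \<open>n - t\<close>. So a failing ordering \<open>\<alpha>\<close> yields distinct \<open>f, g\<close> of degree below \<open>k\<close> and index sets
  \<open>I, J\<close> of size at least \<open>9n/10\<close> on which \<open>f(\<alpha>)\<close> and \<open>g(\<alpha>)\<close> agree. Since \<open>\<alpha>\<close> has no repetitions,
  the paired indices coincide fewer than \<open>k\<close> times, so at least \<open>2n/5\<close> distinct positions \<open>m\<close>
  are the larger member of a pair. Reading \<open>\<alpha>\<close> from left to right, each such entry is confined
  to a fibre of \<open>f\<close> or \<open>g\<close>, that is, to fewer than \<open>k\<close> values determined by the prefix. The
  union bound over the at most \<open>n^(2k) 4^n\<close> choices of \<open>(f, g, I, J)\<close> then stays below \<open>n!\<close>.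
\<close>

lemma insdel_error_sym: "insdel_error v w \<Longrightarrow> insdel_error w v"
  unfolding insdel_error_def insertion_def deletion_def by blast

lemma insdel_error_pow_sym: "(insdel_error ^^ m) v w \<Longrightarrow> (insdel_error ^^ m) w v"
proof (induction m arbitrary: w)
  case (Suc m)
  then obtain u where "(insdel_error ^^ m) v u" "insdel_error u w"
    by auto
  then show ?case
    using Suc.IH insdel_error_sym by (metis relpowp_Suc_I2)
qed simp

lemma subseq_delete:
  assumes "subseq z (xs @ a # ys)"
  shows "\<exists>z'. subseq z' z \<and> subseq z' (xs @ ys) \<and> length z \<le> Suc (length z')"
proof -
  obtain z1 z2 where z: "z = z1 @ z2" "subseq z1 xs" "subseq z2 (a # ys)"
    using assms subseq_appendE by blast
  show ?thesis
  proof (cases "subseq z2 ys")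
    case True
    then have "subseq z (xs @ ys)"
      using z(1,2) by (simp add: list_emb_append_mono)
    then show ?thesis
      by (intro exI[of _ z]) simp
  next
    case False
    then obtain z3 where z3: "z2 = a # z3" "subseq z3 ys"
      using z(3) by (cases z2) (auto split: if_splits)
    have "subseq (z1 @ z3) z"
      unfolding z(1) z3(1) subseq_append' by (rule list_emb_Cons) simp
    moreover have "subseq (z1 @ z3) (xs @ ys)"
      using z(2) z3(2) by (rule list_emb_append_mono)
    moreover have "length z \<le> Suc (length (z1 @ z3))"
      using z(1) z3(1) by simp
    ultimately show ?thesis
      by blast
  qed
qed

text \<open>An insertion adds one on the left and keeps \<open>z\<close>. A deletion takes one from
  the left but may shorten \<open>z\<close>, which costs two on the right. One more error pays for
  either.\<close>

lemma insdel_error_pow_common_subseq: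
  assumes "(insdel_error ^^ m) v w"
  shows "\<exists>z. subseq z v \<and> subseq z w \<and> length v + length w \<le> 2 * length z + m"
  using assms
proof (induction m arbitrary: w)
  case (Suc m)
  then obtain u where "(insdel_error ^^ m) v u" and uw: "insdel_error u w"
    by auto
  then obtain z where z: "subseq z v" "subseq z u" "length v + length u \<le> 2 * length z + m"
    using Suc.IH by blast
  from uw consider xs a ys where "u = xs @ ys" "w = xs @ a # ys"
    | xs a ys where "u = xs @ a # ys" "w = xs @ ys"
    unfolding insdel_error_def insertion_def deletion_def by blast
  then show ?case
  proof cases
    case 1
    have "subseq u w"
      using 1 by (simp add: subseq_append' list_emb_Cons)
    then show ?thesis
      using 1 z by (intro exI[of _ z]) (auto intro: subseq_order.trans)
  next
    case 2
    then obtain z' where "subseq z' z" "subseq z' w" "length z \<le> Suc (length z')"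
      using subseq_delete z(2) by metis
    then show ?thesis
      using 2 z by (intro exI[of _ z']) (auto intro: subseq_order.trans)
  qed
qed auto

text \<open>Errors are reversible, so \<open>v\<close> leads to \<open>v'\<close> through
  \<open>w\<close> in at most \<open>2 * t\<close> errors; halving the length bound then gives
  \<open>n - t\<close>.\<close>

lemma obtainable_common_subseq:
  assumes "obtainable t v w" "obtainable t v' w" "length v = n" "length v' = n"
  shows "\<exists>z. subseq z v \<and> subseq z v' \<and> real n - t \<le> real (length z)"
proof -
  obtain m m' where m: "real m \<le> t" "real m' \<le> t" "(insdel_error ^^ m) v w" "(insdel_error ^^ m') v' w"
    using assms unfolding obtainable_def by blast
  then have "(insdel_error ^^ (m + m')) v v'"
    using insdel_error_pow_sym by (metis relpowp_add relcomppI)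
  then obtain z where z: "subseq z v" "subseq z v'" "length v + length v' \<le> 2 * length z + (m + m')"
    using insdel_error_pow_common_subseq by blast
  have "2 * real n \<le> 2 * real (length z) + (real m + real m')"
    using z(3) assms(3,4) by linarith
  then show ?thesis
    using z m by (intro exI[of _ z]) linarith
qed

section \<open>Counting lists, polynomial fibres and differing index pairs\<close>

text \<open>Append entries one by one: the prefix fixes the set \<open>F m p\<close>, so each
  position contributes its own factor although the allowed sets vary with the list.\<close>

lemma card_lists_prefix_constrained:
  fixes F :: "nat \<Rightarrow> 'a::finite list \<Rightarrow> 'a set"
  assumes "\<And>m p. m \<in> M \<Longrightarrow> card (F m p) \<le> K"
  shows "card {xs. length xs = n \<and> (\<forall>m<n. m \<in> M \<longrightarrow> xs ! m \<in> F m (take m xs))}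
           \<le> (\<Prod>m<n. if m \<in> M then K else CARD('a))"
proof (induction n)
  case (Suc n)
  let ?S = "\<lambda>n. {xs. length xs = n \<and> (\<forall>m<n. m \<in> M \<longrightarrow> xs ! m \<in> F m (take m xs))}"
  let ?G = "\<lambda>xs. if n \<in> M then F n xs else UNIV"
  have fin: "finite (?S n)"
    using finite_lists_length_eq[of "UNIV :: 'a set" n] by (rule rev_finite_subset) auto
  have "?S (Suc n) \<subseteq> (\<Union>xs\<in>?S n. (\<lambda>a. xs @ [a]) ` ?G xs)"
  proof
    fix ys assume ys: "ys \<in> ?S (Suc n)"
    then obtain xs a where [simp]: "ys = xs @ [a]"
      by (cases ys rule: rev_cases) auto
    have len: "length xs = n"
      using ys by simp
    have "xs ! m \<in> F m (take m xs)" if "m < n" "m \<in> M" for m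
      using ys that len by (auto simp: nth_append dest!: spec[of _ m])
    moreover have "a \<in> ?G xs"
      using ys len by (auto dest!: spec[of _ n])
    ultimately show "ys \<in> (\<Union>xs\<in>?S n. (\<lambda>a. xs @ [a]) ` ?G xs)"
      using len by auto
  qed
  then have "card (?S (Suc n)) \<le> card (\<Union>xs\<in>?S n. (\<lambda>a. xs @ [a]) ` ?G xs)"
    by (rule card_mono[rotated]) (use fin in auto)
  also have "\<dots> \<le> (\<Sum>xs\<in>?S n. card ((\<lambda>a. xs @ [a]) ` ?G xs))"
    by (rule card_UN_le[OF fin])
  also have "\<dots> \<le> (\<Sum>xs\<in>?S n. if n \<in> M then K else CARD('a))"
    by (rule sum_mono) (use assms in \<open>auto simp: card_image inj_on_def\<close>)
  also have "\<dots> = card (?S n) * (if n \<in> M then K else CARD('a))"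
    by simp
  also have "\<dots> \<le> (\<Prod>m<n. if m \<in> M then K else CARD('a)) * (if n \<in> M then K else CARD('a))"
    by (rule mult_right_mono[OF Suc.IH]) simp
  finally show ?case
    by simp
qed simp

text \<open>The fibre is the root set of the nonzero polynomial \<open>f - [:c:]\<close>. Only the
  constant \<open>c\<close> itself is excluded: any other constant has an empty fibre.\<close>

lemma card_poly_fibre:
  fixes f :: "'a::field poly"
  assumes "degree f < k" "f \<noteq> [:c:]"
  shows "card {x. poly f x = c} \<le> k - 1"
proof -
  have "{x. poly f x = c} = {x. poly (f - [:c:]) x = 0}"
    by simp
  moreover have "card \<dots> \<le> degree (f - [:c:])"
    using assms by (intro card_poly_roots_bound) simp
  moreover have "degree (f - [:c:]) \<le> degree f"
    by (rule degree_diff_le) auto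
  ultimately show ?thesis
    using assms by simp
qed

text \<open>A number \<open>m\<close> is the maximum of at most two differing pairs, one with \<open>is ! j = m\<close> and one with \<open>js ! j = m\<close>.\<close>
lemma card_differing_le:
  fixes "is" js :: "nat list"
  assumes "distinct is" "distinct js" "length is = l" "length js = l"
  defines "D \<equiv> {j. j < l \<and> is ! j \<noteq> js ! j}"
  shows "card D \<le> 2 * card ((\<lambda>j. max (is ! j) (js ! j)) ` D)"
proof -
  let ?M = "(\<lambda>j. max (is ! j) (js ! j)) ` D"
  have fin: "finite D"
    unfolding D_def by simp
  have "inj_on (nth is) {..<l}" "inj_on (nth js) {..<l}"
    using assms(1-4) by (auto simp: inj_on_def nth_eq_iff_index_eq)
  then have inj: "inj_on (nth is) {j\<in>D. js ! j < is ! j}" "inj_on (nth js) {j\<in>D. is ! j < js ! j}"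
    by (auto simp: D_def inj_on_def)
  have "card {j\<in>D. js ! j < is ! j} \<le> card ?M"
    by (rule card_inj_on_le[OF inj(1)]) (use fin in \<open>auto intro!: rev_image_eqI simp: max_def\<close>)
  moreover have "card {j\<in>D. is ! j < js ! j} \<le> card ?M"
    by (rule card_inj_on_le[OF inj(2)]) (use fin in \<open>auto intro!: rev_image_eqI simp: max_def\<close>)
  moreover have "D = {j\<in>D. js ! j < is ! j} \<union> {j\<in>D. is ! j < js ! j}"
    unfolding D_def by auto
  then have "card D \<le> card {j\<in>D. js ! j < is ! j} + card {j\<in>D. is ! j < js ! j}"
    by (metis (no_types, lifting) card_Un_le)
  ultimately show ?thesis
    by linarith
qed

section \<open>Orderings along which two polynomials agree\<close>

lemma nths_eq_map_nth: "nths xs I = map ((!) xs) (nths [0..<length xs] I)"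
  by (metis map_nth nths_map)

text \<open>The orderings charged to one choice in the union bound. The ratio 9/10 is
  \<open>1 - 1 / (10 * k)\<close> at its smallest, \<open>k = 1\<close>; equality of the mapped
  lists passes the length bound on to \<open>J\<close>.\<close>

definition agreeing_orderings :: "nat \<Rightarrow> 'a::field poly \<Rightarrow> 'a poly \<Rightarrow> nat set \<Rightarrow> nat set \<Rightarrow> 'a list set" where
  "agreeing_orderings n f g I J = {\<alpha>. length \<alpha> = n \<and> distinct \<alpha> \<and> map (poly f) (nths \<alpha> I) = map (poly g) (nths \<alpha> J)
     \<and> 9 * n \<le> 10 * length (nths \<alpha> I)}"

lemma prod_if_const:
  fixes K Q :: nat
  assumes "M \<subseteq> {..<n}"
  shows "(\<Prod>m<n. if m \<in> M then K else Q) = K ^ card M * Q ^ (n - card M)"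
proof -
  have "{..<n} \<inter> M = M" "{..<n} \<inter> - M = {..<n} - M" "finite M"
    using assms finite_subset by auto
  then show ?thesis
    using assms by (simp add: prod.If_cases card_Diff_subset)
qed

text \<open>The set \<open>M\<close> of larger indices depends on \<open>I\<close> and
  \<open>J\<close> alone, so one system of prefix constraints holds for all orderings counted, and
  \<open>s\<close> can be taken as \<open>card M\<close> unless there are none.\<close>

lemma card_agreeing_orderings_le:
  fixes f g :: "'a::{finite,field} poly"
  assumes deg: "degree f < k" "degree g < k" and "f \<noteq> g"
    and small: "10 * k \<le> n" and n: "n = CARD('a)"
  shows "\<exists>s. 2 * n \<le> 5 * s \<and> s \<le> n \<and> card (agreeing_orderings n f g I J) \<le> k ^ s * n ^ (n - s)"
proof (cases "agreeing_orderings n f g I J = {}")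
  case True
  then show ?thesis
    by (intro exI[of _ n]) auto
next
  case False
  define "is" js where "is = nths [0..<n] I" and "js = nths [0..<n] J"
  define l where "l = length is"
  define D where "D = {j. j < l \<and> is ! j \<noteq> js ! j}"
  define M where "M = (\<lambda>j. max (is ! j) (js ! j)) ` D"
  have dist: "distinct is" "distinct js"
    unfolding is_def js_def by simp_all
  have lt: "x < n" if "x \<in> set is \<union> set js" for x
    using that unfolding is_def js_def by (auto dest: in_set_nthsD)
  have badD: "length js = l \<and> 9 * n \<le> 10 * l \<and> length \<alpha> = n \<and> distinct \<alpha>
      \<and> (\<forall>j<l. poly f (\<alpha> ! (is ! j)) = poly g (\<alpha> ! (js ! j)))" if "\<alpha> \<in> agreeing_orderings n f g I J" for \<alpha>
  proof -
    have 1: "length \<alpha> = n" "distinct \<alpha>" "9 * n \<le> 10 * length (nths \<alpha> I)"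
      "map (poly f) (nths \<alpha> I) = map (poly g) (nths \<alpha> J)"
      using that unfolding agreeing_orderings_def by auto
    have 2: "nths \<alpha> I = map ((!) \<alpha>) is" "nths \<alpha> J = map ((!) \<alpha>) js"
      using 1(1) nths_eq_map_nth unfolding is_def js_def by blast+
    have 3: "length js = l"
      using arg_cong[OF 1(4), of length] unfolding 2 l_def by simp
    have "poly f (\<alpha> ! (is ! j)) = poly g (\<alpha> ! (js ! j))" if "j < l" for j
      using arg_cong[OF 1(4), of "\<lambda>xs. xs ! j"] that 3 unfolding 2 l_def by simp
    with 1 2 3 show ?thesis
      by (simp add: l_def)
  qed
  \<comment> \<open>One member suffices: the equal lengths, the nonconstancy of \<open>f\<close> and
    \<open>g\<close> and the size of \<open>M\<close> derived from it do not mention the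
    ordering.\<close>
  from False obtain \<alpha> where \<alpha>: "\<alpha> \<in> agreeing_orderings n f g I J"
    by blast
  have len: "length js = l" "9 * n \<le> 10 * l" "length \<alpha> = n" "distinct \<alpha>"
    and eq: "\<And>j. j < l \<Longrightarrow> poly f (\<alpha> ! (is ! j)) = poly g (\<alpha> ! (js ! j))"
    using badD[OF \<alpha>] by auto
  have ltj: "is ! j < n" "js ! j < n" if "j < l" for j
    using lt that len by (auto simp: l_def)
  have inj\<alpha>: "inj_on (nth \<alpha>) {..<n}"
    using len by (auto simp: inj_on_def nth_eq_iff_index_eq)
  have inj: "inj_on (nth is) {..<l}" "inj_on (nth js) {..<l}"
    using dist len by (auto simp: inj_on_def nth_eq_iff_index_eq l_def)
  \<comment> \<open>Indices yield equally many field elements, so bounds on roots become bounds on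
    indices.\<close>
  have card_inj: "card A \<le> card {x. P x}"
    if "A \<subseteq> {..<l}" "\<And>j. j \<in> A \<Longrightarrow> P (\<alpha> ! (xs ! j))" "inj_on (nth xs) {..<l}" "\<And>j. j < l \<Longrightarrow> xs ! j < n" for A P xs
  proof (rule card_inj_on_le)
    show "inj_on (\<lambda>j. \<alpha> ! (xs ! j)) A"
      using that(1,3,4) inj\<alpha> unfolding inj_on_def by (meson lessThan_iff subsetD)
  qed (use that in auto)
  have big: "k \<le> l"
    using small len by linarith
  \<comment> \<open>If \<open>g\<close> were constant, \<open>f\<close> would take that value at
    \<open>l \<ge> k\<close> elements and be the same constant, against \<open>f \<noteq> g\<close>.
    Nonconstancy is what bounds the sets \<open>F m p\<close> below.\<close>
  have nonconst_g: "g \<noteq> [:c:]" for c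
  proof
    assume g: "g = [:c:]"
    have "card {..<l} \<le> card {x. poly f x = c}"
      by (rule card_inj[where xs = "is"]) (use eq g inj ltj in auto)
    moreover have "card {x. poly f x = c} \<le> k - 1"
      by (rule card_poly_fibre) (use assms g in auto)
    ultimately show False
      using big deg by simp
  qed
  have nonconst_f: "f \<noteq> [:c:]" for c
  proof
    assume f: "f = [:c:]"
    have "card {..<l} \<le> card {x. poly g x = c}"
      by (rule card_inj[where xs = js]) (use eq[symmetric] f inj ltj in auto)
    moreover have "card {x. poly g x = c} \<le> k - 1"
      by (rule card_poly_fibre) (use assms f in auto)
    ultimately show False
      using big deg by simp
  qed
  have "poly (f - g) (\<alpha> ! (is ! j)) = 0" if "j \<in> {..<l} - D" for j
    using eq[of j] that by (simp add: D_def)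
  then have "card ({..<l} - D) \<le> card {x. poly (f - g) x = 0}"
    by (intro card_inj[where xs = "is"]) (use inj ltj in auto)
  also have "\<dots> \<le> degree (f - g)"
    using \<open>f \<noteq> g\<close> by (intro card_poly_roots_bound) simp
  also have "\<dots> < k"
    using deg by (rule degree_diff_less)
  finally have "l - card D < k"
    by (simp add: card_Diff_subset D_def subset_eq)
  moreover have "card D \<le> 2 * card M"
    unfolding M_def D_def by (rule card_differing_le) (use dist len in \<open>auto simp: l_def\<close>)
  \<comment> \<open>\<open>card D\<close> exceeds 9n/10 - n/10 = 4n/5, and at most two pairs share a
    maximum.\<close>
  ultimately have s: "2 * n \<le> 5 * card M"
    using len small by linarith
  have Mn: "M \<subseteq> {..<n}"
    using ltj by (auto simp: M_def D_def)
  \<comment> \<open>Two pairs may have maximum \<open>m\<close>; either gives a usable constraint,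
    so one is picked.\<close>
  define w where "w m = (SOME j. j \<in> D \<and> m = max (is ! j) (js ! j))" for m
  have w: "w m \<in> D \<and> m = max (is ! (w m)) (js ! (w m))" if "m \<in> M" for m
    unfolding w_def by (rule someI_ex) (use that in \<open>auto simp: M_def\<close>)
  \<comment> \<open>The other index of the pair is smaller than \<open>m\<close>, so its entry is
    read off the prefix \<open>p\<close>, and the entry at \<open>m\<close> lies in a fibre over a
    known value.\<close>
  define F where "F m p = (if is ! (w m) = m then {x. poly f x = poly g (p ! (js ! (w m)))}
      else {x. poly g x = poly f (p ! (is ! (w m)))})" for m p
  have "card (F m p) \<le> k" for m p
    using card_poly_fibre[OF deg(1) nonconst_f, THEN le_trans, OF diff_le_self]
      card_poly_fibre[OF deg(2) nonconst_g, THEN le_trans, OF diff_le_self]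
    unfolding F_def by simp
  then have *: "card {xs. length xs = n \<and> (\<forall>m<n. m \<in> M \<longrightarrow> xs ! m \<in> F m (take m xs))}
           \<le> (\<Prod>m<n. if m \<in> M then k else CARD('a))"
    by (rule card_lists_prefix_constrained)
  have "agreeing_orderings n f g I J \<subseteq> {xs. length xs = n \<and> (\<forall>m<n. m \<in> M \<longrightarrow> xs ! m \<in> F m (take m xs))}"
  proof safe
    fix \<beta> assume \<beta>: "\<beta> \<in> agreeing_orderings n f g I J"
    show "length \<beta> = n"
      using badD[OF \<beta>] by simp
    fix m assume m: "m < n" "m \<in> M"
    have j: "w m < l" "is ! w m \<noteq> js ! w m" "m = max (is ! w m) (js ! w m)"
      using w[OF m(2)] by (auto simp: D_def)
    then have "poly f (\<beta> ! (is ! w m)) = poly g (\<beta> ! (js ! w m))"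
      using badD[OF \<beta>] by blast
    with j show "\<beta> ! m \<in> F m (take m \<beta>)"
      by (cases "is ! w m < js ! w m") (auto simp: F_def)
  qed
  then have "card (agreeing_orderings n f g I J) \<le> card {xs. length xs = n \<and> (\<forall>m<n. m \<in> M \<longrightarrow> xs ! m \<in> F m (take m xs))}"
    by (rule card_mono[rotated])
      (rule rev_finite_subset[OF finite_lists_length_eq[of "UNIV :: 'a set" n]], auto)
  also note *
  also have "(\<Prod>m<n. if m \<in> M then k else CARD('a)) = k ^ card M * n ^ (n - card M)"
    using prod_if_const[OF Mn] n by simp
  finally show ?thesis
    using s card_mono[OF _ Mn] by (intro exI[of _ "card M"]) auto
qed

section \<open>The number of polynomials and numerical estimates\<close>

text \<open>Coefficient lists padded to length \<open>k\<close> map onto these polynomials.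
  Finiteness is included because the polynomial type is infinite and \<open>card\<close> is 0 on
  infinite sets.\<close>

lemma card_degree_less_le:
  "finite {f :: 'a::{finite,field} poly. degree f < k} \<and>
   card {f :: 'a poly. degree f < k} \<le> CARD('a) ^ k"
proof -
  let ?L = "{xs :: 'a list. set xs \<subseteq> UNIV \<and> length xs = k}"
  have sub: "{f :: 'a poly. degree f < k} \<subseteq> Poly ` ?L"
  proof
    fix f :: "'a poly" assume "f \<in> {f. degree f < k}"
    then have "f = Poly (map (coeff f) [0..<k])"
      by (intro poly_eqI) (auto simp: nth_default_def intro: coeff_eq_0)
    then show "f \<in> Poly ` ?L"
      by (intro image_eqI) auto
  qed
  have L: "finite ?L" "card ?L = CARD('a) ^ k"
    by (rule finite_lists_length_eq, simp) (rule card_lists_length_eq, simp)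
  show ?thesis
    using finite_surj[OF L(1) sub] surj_card_le[OF L(1) sub] unfolding L(2) by (rule conjI)
qed

text \<open>The quotient of \<open>n ^ n\<close> by \<open>fact n\<close> is a single term of the
  exponential series at \<open>n\<close>.\<close>

lemma exp_mult_fact_ge: "real n ^ n \<le> exp (real n) * fact n"
proof -
  have "(\<Sum>i\<in>{n}. inverse (fact i) * real n ^ i) \<le> exp (real n)"
    unfolding exp_def
    unfolding real_scaleR_def by (rule sum_le_suminf[OF summable_exp]) auto
  then show ?thesis
    by (simp add: field_simps)
qed

text \<open>These provide, in turn: more positions than roots, a gain of \<open>exp 9\<close> at
  each constrained position, and at most \<open>exp (2 / 3 * n)\<close> pairs of
  polynomials.\<close>

lemma field_size_bounds:
  fixes k n :: nat
  assumes "k \<ge> 1" and n: "real n \<ge> exp (6 * real k) * (10 * exp 1 * real k ^ 3)"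
  shows "10 * k \<le> n" "exp 9 * real k \<le> real n" "2 * real k * ln (real n) \<le> 2 / 3 * real n"
proof -
  have k: "real k \<le> real k ^ 3"
    using assms(1) by (intro self_le_power) auto
  have "exp 2 = (exp 1 :: real) ^ 2"
    by (simp flip: exp_of_nat_mult)
  also have "\<dots> \<le> 3 ^ 2"
    by (intro power_mono exp_le) auto
  finally have e2: "exp 2 \<le> (10 :: real)"
    by simp
  have e6: "exp 6 \<le> exp (6 * real k)"
    using assms(1) by simp
  have "exp 9 * real k = exp 6 * (exp 2 * exp 1 * real k)"
    \<comment> \<open>The exponent is 9 = 6 + 2 + 1: \<open>exp 6\<close> is bounded by
      \<open>exp (6 * k)\<close>, \<open>exp 2\<close> by 10, and \<open>exp 1\<close> is
      kept.\<close>
    by (simp flip: exp_add)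
  also have "\<dots> \<le> exp (6 * real k) * (10 * exp 1 * real k ^ 3)"
    using e2 e6 k by (intro mult_mono) auto
  finally show 9: "exp 9 * real k \<le> real n"
    using n by linarith
  have "10 * real k \<le> exp 9 * real k"
    using exp_ge_add_one_self[of "9 :: real"] by (intro mult_right_mono) auto
  with 9 show "10 * k \<le> n"
    by linarith
  have "exp (6 * real k) * 1 \<le> exp (6 * real k) * (10 * exp 1 * real k ^ 3)"
  proof (intro mult_left_mono)
    have "1 * 1 * 1 \<le> 10 * exp 1 * real k ^ 3"
      using assms(1) by (intro mult_mono) auto
    then show "1 \<le> 10 * exp 1 * real k ^ 3"
      by simp
  qed auto
  then have 6: "exp (6 * real k) \<le> real n"
    using n by linarith
  then have pos: "real n > 0"
    using exp_gt_zero less_le_trans by blast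
  then have ln6: "6 * real k \<le> ln (real n)"
    using 6 by (simp add: ln_ge_iff)
  \<comment> \<open>From \<open>k \<le> ln n / 6\<close> the left side is at most a third of the
    square of \<open>ln n\<close>; the quadratic Taylor term bounds half that square by
    \<open>n\<close>.\<close>
  have "2 * real k * ln (real n) \<le> ln (real n) / 3 * ln (real n)"
    using ln6 assms(1) by (intro mult_right_mono) auto
  moreover have "1 + ln (real n) + (ln (real n))\<^sup>2 / 2 \<le> real n"
    using exp_lower_Taylor_quadratic[of "ln (real n)"] ln6 pos by simp
  ultimately show "2 * real k * ln (real n) \<le> 2 / 3 * real n"
    using ln6 by (simp add: power2_eq_square)
qed

text \<open>Each of the \<open>s\<close> constrained positions saves a factor \<open>exp 9\<close>
  against \<open>n\<close>, and 9 * 2/5 = 18/5.\<close>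

lemma constrained_count_le:
  fixes k n s :: nat
  assumes "exp 9 * real k \<le> real n" "2 * n \<le> 5 * s" "s \<le> n"
  shows "real (k ^ s * n ^ (n - s)) \<le> exp (- (18 / 5 * real n)) * real n ^ n"
proof -
  have "real k ^ s \<le> (exp (- 9) * real n) ^ s"
    using assms(1) by (intro power_mono) (auto simp: exp_minus field_simps)
  also have "\<dots> = exp (- (9 * real s)) * real n ^ s"
    by (simp add: power_mult_distrib mult.commute flip: exp_of_nat_mult)
  also have "\<dots> \<le> exp (- (18 / 5 * real n)) * real n ^ s"
    using assms(2) by (intro mult_right_mono) auto
  finally have "real k ^ s * real n ^ (n - s) \<le> exp (- (18 / 5 * real n)) * real n ^ s * real n ^ (n - s)"
    by (intro mult_right_mono) auto
  then show ?thesis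
    using assms(3) by (simp add: mult.assoc flip: power_add)
qed

text \<open>Relative to \<open>fact n\<close>, the exponents per unit of \<open>n\<close> are 2/3
  for the polynomials, 3/2 for the index sets, 1 for \<open>n ^ n\<close> and -18/5 for the
  constraints; they sum to -13/30.\<close>

lemma union_bound_less_fact:
  fixes k n :: nat
  assumes "n \<ge> 1" and ln: "2 * real k * ln (real n) \<le> 2 / 3 * real n"
  shows "(real n ^ k)\<^sup>2 * (2 ^ n)\<^sup>2 * (exp (- (18 / 5 * real n)) * real n ^ n) < fact n"
proof -
  \<comment> \<open>The left side is 2197/512, the cube of 13/8, which exceeds 4.\<close>
  have "(1 + 1 / 2 + (1 / 2)\<^sup>2 / 2) ^ 3 \<le> (exp (1 / 2) :: real) ^ 3"
    by (intro power_mono exp_lower_Taylor_quadratic) auto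
  also have "\<dots> = exp (3 / 2)"
    by (simp flip: exp_of_nat_mult)
  finally have "4 \<le> (exp (3 / 2) :: real)"
    by (simp add: power2_eq_square power3_eq_cube)
  then have "4 ^ n \<le> (exp (3 / 2) :: real) ^ n"
    by (intro power_mono) auto
  also have "(exp (3 / 2) :: real) ^ n = exp (3 / 2 * real n)"
    by (simp add: mult.commute flip: exp_of_nat_mult)
  finally have four: "(2 ^ n)\<^sup>2 \<le> exp (3 / 2 * real n)"
    by (simp add: power2_eq_square flip: power_mult_distrib)
  have "(real n ^ k)\<^sup>2 = exp (2 * real k * ln (real n))"
    using assms(1) exp_of_nat_mult[of "2 * k" "ln (real n)"] by (simp add: mult.commute flip: power_mult)
  also have "\<dots> \<le> exp (2 / 3 * real n)"
    using ln by simp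
  finally have "(real n ^ k)\<^sup>2 * (2 ^ n)\<^sup>2 * (exp (- (18 / 5 * real n)) * real n ^ n)
      \<le> exp (2 / 3 * real n) * exp (3 / 2 * real n) * (exp (- (18 / 5 * real n)) * (exp (real n) * fact n))"
    using four exp_mult_fact_ge[of n] by (intro mult_mono) auto
  also have "\<dots> = exp (- (13 / 30 * real n)) * fact n"
    by (simp add: field_simps flip: exp_add)
  also have "\<dots> < 1 * fact n"
    using assms(1) by (intro mult_strict_right_mono) auto
  finally show ?thesis
    by simp
qed

section \<open>From uncorrectable errors to the union bound\<close>

text \<open>Index sets select the common subsequence from both codewords, and evaluation commutes
  with selection. As \<open>k \<ge> 1\<close>, at most n/10 positions are omitted.\<close>

lemma not_corrects_insdel_RS_imp_agreeing:
  fixes \<alpha> :: "'a::field list"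
  assumes "k \<ge> 1" "length \<alpha> = n" "distinct \<alpha>" "\<not> corrects_insdel (RS \<alpha> k) (real n / (10 * real k))"
  shows "\<exists>f g I J. degree f < k \<and> degree g < k \<and> f \<noteq> g \<and> I \<subseteq> {..<n} \<and> J \<subseteq> {..<n} \<and> \<alpha> \<in> agreeing_orderings n f g I J"
proof -
  obtain c c' w where c: "c \<in> RS \<alpha> k" "c' \<in> RS \<alpha> k" "c \<noteq> c'"
    "obtainable (real n / (10 * real k)) c w" "obtainable (real n / (10 * real k)) c' w"
    using assms(4) unfolding corrects_insdel_def by blast
  \<comment> \<open>As \<open>k \<ge> 1\<close>, the library value \<open>degree 0 = 0\<close> lies
    below \<open>k\<close>, which absorbs the separate zero case.\<close>
  have RS: "RS \<alpha> k = {map (poly f) \<alpha> | f. degree f < k}"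
    using assms(1) unfolding RS_def by (metis degree_0 less_le_trans zero_less_one)
  obtain f g where fg: "c = map (poly f) \<alpha>" "c' = map (poly g) \<alpha>" "degree f < k" "degree g < k"
    using c(1,2) unfolding RS by blast
  obtain z where z: "subseq z c" "subseq z c'" "real n - real n / (10 * real k) \<le> real (length z)"
    using obtainable_common_subseq[OF c(4,5)] fg assms(2) by auto
  \<comment> \<open>Cutting index sets down to \<open>{..<n}\<close> leaves \<open>2 ^ n\<close>
    choices for each.\<close>
  have nths_restrict: "nths xs I = nths xs (I \<inter> {..<length xs})" for xs :: "'a list" and I
    unfolding nths_def by (rule arg_cong[of _ _ "map fst"], rule filter_cong) (auto simp: in_set_zip)
  obtain I J where IJ: "z = nths c I" "z = nths c' J"
    using z(1,2) subseq_conv_nths by metis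
  have eq: "z = map (poly f) (nths \<alpha> (I \<inter> {..<n}))" "z = map (poly g) (nths \<alpha> (J \<inter> {..<n}))"
    using IJ fg assms(2) nths_restrict[of \<alpha>] by (simp_all add: nths_map)
  have "real n / (10 * real k) \<le> real n / 10"
    using assms(1) by (intro divide_left_mono) auto
  then have "9 * real n \<le> 10 * real (length z)"
    using z(3) by linarith
  then have "9 * n \<le> 10 * length (nths \<alpha> (I \<inter> {..<n}))"
    using eq(1) by (metis (mono_tags) length_map of_nat_le_iff of_nat_mult of_nat_numeral)
  then have "\<alpha> \<in> agreeing_orderings n f g (I \<inter> {..<n}) (J \<inter> {..<n})"
    unfolding agreeing_orderings_def using assms(2,3) eq by simp
  moreover have "f \<noteq> g"
    using c(3) fg by auto
  ultimately show ?thesis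
    using fg(3,4) by (intro exI[of _ f] exI[of _ g] exI[of _ "I \<inter> {..<n}"] exI[of _ "J \<inter> {..<n}"]) simp
qed

theorem theorem2:
  fixes k q :: nat
  assumes "k \<ge> 1"
    and "primepow q"
    and "CARD('a) = q"
    and "real q \<ge> exp (6 * real k) * (10 * exp 1 * real k ^ 3)"
  shows "\<exists>\<alpha> :: 'a::{finite,field} list. length \<alpha> = q \<and> distinct \<alpha> \<and> set \<alpha> = UNIV \<and>
           corrects_insdel (RS \<alpha> k) (real q / (10 * real k))"
proof (rule ccontr)
  assume neg: "\<not> ?thesis"
  note bounds = field_size_bounds[OF assms(1,4)]
  define P where "P = {f :: 'a poly. degree f < k}"
  define T where "T = {(f, g, I, J). f \<in> P \<and> g \<in> P \<and> f \<noteq> g \<and> I \<subseteq> {..<q} \<and> J \<subseteq> {..<q}}"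
  define C where "C = exp (- (18 / 5 * real q)) * real q ^ q"
  let ?A = "{\<alpha> :: 'a list. length \<alpha> = q \<and> distinct \<alpha> \<and> set \<alpha> \<subseteq> UNIV}"
  let ?U = "P \<times> P \<times> Pow {..<q} \<times> Pow {..<q}"
  let ?agreeing_orderings = "\<lambda>(f, g, I, J). agreeing_orderings q f g I J"
  have P: "finite P" "card P \<le> q ^ k"
    using card_degree_less_le[where 'a = 'a and k = k] assms(3) unfolding P_def by auto
  have TU: "T \<subseteq> ?U"
    unfolding T_def by auto
  have finU: "finite ?U"
    using P by simp
  have finT: "finite T"
    using finU TU by (rule rev_finite_subset)
  have "card T \<le> card ?U"
    using finU TU by (rule card_mono)
  also have "card ?U = (card P)\<^sup>2 * (2 ^ q)\<^sup>2"
    by (simp add: card_cartesian_product card_Pow power2_eq_square)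
  also have "\<dots> \<le> (q ^ k)\<^sup>2 * (2 ^ q)\<^sup>2"
    using P by (intro mult_right_mono power_mono) auto
  finally have cardT: "card T \<le> (q ^ k)\<^sup>2 * (2 ^ q)\<^sup>2" .
  \<comment> \<open>A repetition-free list of length \<open>q\<close> exhausts the field, so the
    negated claim makes every such list fail.\<close>
  have cover: "?A \<subseteq> (\<Union>t\<in>T. ?agreeing_orderings t)"
  proof
    fix \<alpha> :: "'a list" assume "\<alpha> \<in> ?A"
    then have \<alpha>: "length \<alpha> = q" "distinct \<alpha>"
      by auto
    then have "set \<alpha> = UNIV"
      using assms(3) by (intro card_subset_eq) (auto simp: distinct_card)
    then have "\<not> corrects_insdel (RS \<alpha> k) (real q / (10 * real k))"
      using neg \<alpha> by blast
    then obtain f g I J where "(f, g, I, J) \<in> T" "\<alpha> \<in> agreeing_orderings q f g I J"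
      using not_corrects_insdel_RS_imp_agreeing[OF assms(1) \<alpha>] unfolding T_def P_def by blast
    then show "\<alpha> \<in> (\<Union>t\<in>T. ?agreeing_orderings t)"
      by (intro UN_I[of "(f, g, I, J)"]) simp_all
  qed
  have fin_bad: "finite (?agreeing_orderings t)" for t :: "'a poly \<times> 'a poly \<times> nat set \<times> nat set"
    by (cases t) (auto simp: agreeing_orderings_def intro: rev_finite_subset[OF finite_lists_length_eq[of "UNIV :: 'a set" q]])
  have bad_le: "real (card (?agreeing_orderings t)) \<le> C" if "t \<in> T" for t
  proof -
    obtain f g I J where t: "t = (f, g, I, J)"
      by (cases t)
    have "degree f < k" "degree g < k" "f \<noteq> g"
      using that by (simp_all add: t T_def P_def)
    from card_agreeing_orderings_le[OF this bounds(1) assms(3)[symmetric]] obtain s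
      where s: "2 * q \<le> 5 * s" "s \<le> q" "card (agreeing_orderings q f g I J) \<le> k ^ s * q ^ (q - s)"
      by blast
    have "real (card (agreeing_orderings q f g I J)) \<le> real (k ^ s * q ^ (q - s))"
      using s(3) by (simp only: of_nat_le_iff)
    also have "\<dots> \<le> C"
      unfolding C_def by (rule constrained_count_le[OF bounds(2) s(1,2)])
    finally show ?thesis
      by (simp add: t)
  qed
  have "card ?A = fact q"
    using card_lists_distinct_length_eq[of "UNIV :: 'a set" q] assms(3) by (simp add: fact_prod)
  then have "fact q = real (card ?A)"
    by (metis of_nat_fact)
  also have "\<dots> \<le> real (card (\<Union>t\<in>T. ?agreeing_orderings t))"
    using card_mono[OF _ cover] finT fin_bad by simp
  also have "\<dots> \<le> real (\<Sum>t\<in>T. card (?agreeing_orderings t))"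
    using card_UN_le[OF finT, of ?agreeing_orderings] by (simp only: of_nat_le_iff)
  also have "\<dots> \<le> real (card T) * C"
    unfolding of_nat_sum by (rule sum_bounded_above) (rule bad_le)
  also have "\<dots> \<le> real ((q ^ k)\<^sup>2 * (2 ^ q)\<^sup>2) * C"
    using cardT by (intro mult_right_mono) (simp_all only: of_nat_le_iff, simp add: C_def)
  also have "\<dots> < fact q"
    using union_bound_less_fact[OF _ bounds(3)] bounds(1) assms(1) by (simp add: C_def)
  finally show False
    by simp
qed

end
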